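(* For any integer $m\ge 2$ and for any (strict or weak) ranking pattern $\boldsymbol{\sigma}\in\Sigma^{(m)}$, there exists a voting situation $\mathcal{N}^{(m)}$ which is $q$-concordant with $\boldsymbol{\sigma}$.
   Context: Let $[k]=\{1,\dots,k\}$ (with $[0]=\emptyset$), $[m]$ the set of candidates, and $\Pi_m$ the set of permutations $(j_1,\ldots,j_m)$ of the elements of $[m]$. Ranking functions and patterns. For $A\subseteq[m]$, a map $\sigma(A,\cdot):A\to\{1,\ldots,|A|\}$ is a ranking function if for each $i\in A$, $\sigma(A,i)=1+\left|\{j\in A:\sigma(A,j)\le\sigma(A,i)-1\}\right|$ (ties are allowed). A ranking pattern over $[m]$ ($m\ge2$) is a family $\boldsymbol{\sigma}=\{\sigma(A,\cdot):A\subseteq[m],\,|A|\ge2\}$ of ranking functions. $\Sigma^{(m)}$ denotes the set of all ranking patterns over $[m]$. Voting situations. A voting situation is a family $\mathcal{N}^{(m)}=\{N^{(m)}(j_1,\ldots,j_m):(j_1,\ldots,j_m)\in\Pi_m\}$ of non-negative integers, where $N^{(m)}(j_1,\ldots,j_m)$ is the number of voters (in a finite nonempty set of voters) whose preference ranking, from most to least preferred, is $(j_1,\ldots,j_m)$. For $A\subseteq[m]$ and $i\in A$, $n_i(A)$ is the number of votes obtained by $i$ when $A$ is the set of competing candidates, i.e. the sum of $N^{(m)}(j_1,\ldots,j_m)$ over all $(j_1,\ldots,j_m)\in\Pi_m$ in which $i$ occupies an earlier position than every other element of $A$. Concordance. $\boldsymbol{\sigma}$ and $\mathcal{N}^{(m)}$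 are $q$-concordant if for any $A\subseteq[m]$ and $i,j\in A$ with $i\ne j$: $\sigma(A,i)<\sigma(A,j)\Leftrightarrow n_i(A)>n_j(A)$, and $\sigma(A,i)=\sigma(A,j)\Leftrightarrow n_i(A)=n_j(A)$. *)

theory Defs
  imports "HOL-Combinatorics.Multiset_Permutations"
begin

(* Since f takes values in {1..card A}, the natural-number subtraction below never truncates. *)
definition ranking_function :: "nat set \<Rightarrow> (nat \<Rightarrow> nat) \<Rightarrow> bool" where
  "ranking_function A f \<longleftrightarrow>
     f \<in> A \<rightarrow> {1..card A} \<and> (\<forall>i\<in>A. f i = 1 + card {j \<in> A. f j \<le> f i - 1})"

(* Patterns are total functions; only the values \<sigma> A i with A a subset of {1..m},
   card A \<ge> 2 and i \<in> A are meaningful. *)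
definition ranking_patterns :: "nat \<Rightarrow> (nat set \<Rightarrow> nat \<Rightarrow> nat) set" where
  "ranking_patterns m =
     {\<sigma>. \<forall>A. A \<subseteq> {1..m} \<and> card A \<ge> 2 \<longrightarrow> ranking_function A (\<sigma> A)}"

(* A preference ranking is a list in permutations_of_set {1..m}, most preferred candidate first;
   N js is the number of voters with ranking js, and is meaningful only for such js.
   Positivity of the total says that the set of voters is nonempty. *)
definition voting_situation :: "nat \<Rightarrow> (nat list \<Rightarrow> nat) \<Rightarrow> bool" where
  "voting_situation m N \<longleftrightarrow> (\<Sum>js \<in> permutations_of_set {1..m}. N js) > 0"

definition precedes :: "'a list \<Rightarrow> 'a \<Rightarrow> 'a \<Rightarrow> bool" where
  "precedes js i j \<longleftrightarrow> (\<exists>p q. p < q \<and> q < length js \<and> js ! p = i \<and> js ! q = j)"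

definition votes :: "nat \<Rightarrow> (nat list \<Rightarrow> nat) \<Rightarrow> nat set \<Rightarrow> nat \<Rightarrow> nat" where
  "votes m N A i =
     (\<Sum>js \<in> {js \<in> permutations_of_set {1..m}. \<forall>j \<in> A - {i}. precedes js i j}. N js)"

definition q_concordant :: "nat \<Rightarrow> (nat set \<Rightarrow> nat \<Rightarrow> nat) \<Rightarrow> (nat list \<Rightarrow> nat) \<Rightarrow> bool" where
  "q_concordant m \<sigma> N \<longleftrightarrow>
     (\<forall>A \<subseteq> {1..m}. \<forall>i \<in> A. \<forall>j \<in> A. i \<noteq> j \<longrightarrow>
        (\<sigma> A i < \<sigma> A j \<longleftrightarrow> votes m N A i > votes m N A j) \<and>
        (\<sigma> A i = \<sigma> A j \<longleftrightarrow> votes m N A i = votes m N A j))"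

end

theory Submission
  imports Defs
begin

text \<open>
  Allow integer numbers of voters first. Let \<open>X\<close> be a set of candidates and \<open>i\<close>, \<open>j\<close> two others.
  Adding a voter with ranking \<open>X, i, j, \<dots>\<close> and removing one with ranking \<open>X, j, i, \<dots>\<close>
  moves one vote from \<open>j\<close> to \<open>i\<close> in every contest \<open>B\<close> that contains both and is disjoint from \<open>X\<close>,
  and changes no other contest. By induction on the complement \<open>A\<close> of \<open>X\<close>, one vote can therefore
  be moved in the single contest \<open>A\<close>, so the contests can be treated independently.
  Moving \<open>- \<sigma> A i\<close> votes from \<open>j\<close> to \<open>i\<close> for all \<open>i\<close> and \<open>j\<close> in \<open>A\<close> yields
  margins proportional to the differences of \<open>\<sigma> A\<close>. Finally, adding the same large number of
  voters to every ranking makes the situation non-negative and, by symmetry, keeps all margins.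
\<close>

section \<open>Order of candidates within one ranking\<close>

lemma precedes_Nil [simp]: "\<not> precedes [] a b"
  by (simp add: precedes_def)

lemma precedes_Cons: "precedes (x # xs) a b \<longleftrightarrow> a = x \<and> b \<in> set xs \<or> precedes xs a b"
proof
  assume "precedes (x # xs) a b"
  then obtain p q where pq: "p < q" "q < length (x # xs)" "(x # xs) ! p = a" "(x # xs) ! q = b"
    by (auto simp: precedes_def)
  then obtain q' where q': "q = Suc q'" by (cases q) auto
  show "a = x \<and> b \<in> set xs \<or> precedes xs a b"
    using pq q' by (cases p) (auto simp: precedes_def)
next
  assume "a = x \<and> b \<in> set xs \<or> precedes xs a b"
  then show "precedes (x # xs) a b"
  proof
    assume "a = x \<and> b \<in> set xs"
    then obtain q where "q < length xs" "xs ! q = b" "a = x" by (auto simp: in_set_conv_nth)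
    then show ?thesis unfolding precedes_def by (intro exI[of _ 0] exI[of _ "Suc q"]) auto
  next
    assume "precedes xs a b"
    then obtain p q where "p < q" "q < length xs" "xs ! p = a" "xs ! q = b"
      by (auto simp: precedes_def)
    then show ?thesis unfolding precedes_def by (intro exI[of _ "Suc p"] exI[of _ "Suc q"]) auto
  qed
qed

lemma precedes_in_set: "precedes xs a b \<Longrightarrow> b \<in> set xs"
  by (auto simp: precedes_def)

lemma precedes_map: "inj f \<Longrightarrow> precedes (map f xs) (f a) (f b) \<longleftrightarrow> precedes xs a b"
  by (induction xs) (simp_all add: precedes_Cons inj_image_mem_iff inj_eq)

definition tops :: "'a list \<Rightarrow> 'a set \<Rightarrow> 'a \<Rightarrow> bool" where
  "tops js A i \<longleftrightarrow> (\<forall>j\<in>A - {i}. precedes js i j)"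

lemma tops_iff_hd_filter:
  assumes "distinct js" "A \<subseteq> set js" "k \<in> A"
  shows "tops js A k \<longleftrightarrow> hd (filter (\<lambda>x. x \<in> A) js) = k"
  using assms
proof (induction js)
  case (Cons x xs)
  show ?case
  proof (cases "x \<in> A")
    case True
    then show ?thesis
      using Cons.prems by (auto simp: tops_def precedes_Cons dest: precedes_in_set)
  next
    case False
    with Cons.prems have "A \<subseteq> set xs" "x \<noteq> k" by auto
    with Cons False show ?thesis by (simp add: tops_def precedes_Cons)
  qed
qed simp

section \<open>Integer vote counts and their symmetry\<close>

definition net_votes :: "'a set \<Rightarrow> ('a list \<Rightarrow> int) \<Rightarrow> 'a set \<Rightarrow> 'a \<Rightarrow> int" where
  "net_votes S N A i = (\<Sum>js\<in>{js \<in> permutations_of_set S. tops js A i}. N js)"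

lemma net_votes_add: "net_votes S (\<lambda>js. M js + N js) A i = net_votes S M A i + net_votes S N A i"
  by (simp add: net_votes_def sum.distrib)

lemma net_votes_scale: "net_votes S (\<lambda>js. c * N js) A i = c * net_votes S N A i"
  by (simp add: net_votes_def sum_distrib_left)

text \<open>Swapping \<open>i\<close> and \<open>j\<close> in every ranking permutes the rankings of
  \<open>S\<close>, maps \<open>A\<close> to itself and exchanges the rankings topped by
  \<open>i\<close> with those topped by \<open>j\<close>.\<close>

lemma net_votes_const_symmetric:
  assumes "A \<subseteq> S" "i \<in> A" "j \<in> A"
  shows "net_votes S (\<lambda>_. c) A i = net_votes S (\<lambda>_. c) A j"
proof -
  let ?t = "transpose i j"
  have "i \<in> S" "j \<in> S"
    using assms by auto
  then have tS: "?t ` S = S" and tA: "?t ` A = A"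
    using assms by (simp_all add: transpose_image_eq)
  have tops_map: "tops (map ?t js) A (?t k) \<longleftrightarrow> tops js A k" for js k
  proof -
    have "A - {?t k} = ?t ` (A - {k})"
      by (subst image_set_diff) (use tA in auto)
    then show ?thesis
      by (simp add: tops_def precedes_map)
  qed
  have perm: "map ?t js \<in> permutations_of_set S" if "js \<in> permutations_of_set S" for js
    using that tS by (auto simp: permutations_of_set_def distinct_map intro: inj_on_subset[OF inj_transpose])
  show ?thesis
    unfolding net_votes_def
    by (rule sum.reindex_bij_witness[of _ "map ?t" "map ?t"])
      (use perm tops_map[of _ i] tops_map[of _ j] in \<open>auto simp: o_def\<close>)
qed

section \<open>Closure properties of realizable vote tables\<close>

definition realizable :: "'a set \<Rightarrow> ('a set \<Rightarrow> 'a \<Rightarrow> int) \<Rightarrow> bool" where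
  "realizable S v \<longleftrightarrow> (\<exists>N. \<forall>B\<subseteq>S. \<forall>k\<in>B. net_votes S N B k = v B k)"

lemma realizable_zero: "realizable S (\<lambda>_ _. 0)"
  unfolding realizable_def by (rule exI[of _ "\<lambda>_. 0"]) (simp add: net_votes_def)

lemma realizable_add:
  assumes "realizable S v" "realizable S w"
  shows "realizable S (\<lambda>B k. v B k + w B k)"
proof -
  obtain M N where "\<forall>B\<subseteq>S. \<forall>k\<in>B. net_votes S M B k = v B k" "\<forall>B\<subseteq>S. \<forall>k\<in>B. net_votes S N B k = w B k"
    using assms unfolding realizable_def by blast
  then show ?thesis
    unfolding realizable_def by (intro exI[of _ "\<lambda>js. M js + N js"]) (simp add: net_votes_add)
qed

lemma realizable_scale:
  assumes "realizable S v"
  shows "realizable S (\<lambda>B k. c * v B k)"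
proof -
  obtain N where "\<forall>B\<subseteq>S. \<forall>k\<in>B. net_votes S N B k = v B k"
    using assms unfolding realizable_def by blast
  then show ?thesis
    unfolding realizable_def by (intro exI[of _ "\<lambda>js. c * N js"]) (simp add: net_votes_scale)
qed

lemma realizable_sum:
  assumes "\<And>x. x \<in> I \<Longrightarrow> realizable S (v x)"
  shows "realizable S (\<lambda>B k. \<Sum>x\<in>I. v x B k)"
  using assms
  by (induction I rule: infinite_finite_induct) (auto simp: realizable_zero realizable_add)

lemma realizable_cong:
  assumes "realizable S v" "\<And>B k. B \<subseteq> S \<Longrightarrow> k \<in> B \<Longrightarrow> v B k = w B k"
  shows "realizable S w"
  using assms unfolding realizable_def by simp

section \<open>Transfers of single votes\<close>

definition transfer_vote :: "'a \<Rightarrow> 'a \<Rightarrow> 'a \<Rightarrow> int" where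
  "transfer_vote i j k = of_bool (k = i) - of_bool (k = j)"

lemma realizable_transfer_below:
  assumes "finite S" "A \<subseteq> S" "i \<in> A" "j \<in> A" "i \<noteq> j"
  shows "realizable S (\<lambda>B k. of_bool (i \<in> B \<and> j \<in> B \<and> B \<subseteq> A) * transfer_vote i j k)"
proof -
  obtain xs where xs: "set xs = S - A" "distinct xs"
    using assms finite_distinct_list[of "S - A"] by auto
  obtain ys where ys: "set ys = A - {i, j}" "distinct ys"
    using assms finite_distinct_list[of "A - {i, j}"] by (auto intro: finite_subset)
  define r s where "r = xs @ i # j # ys" and "s = xs @ j # i # ys"
  have dist: "distinct r" "distinct s" and set: "set r = S" "set s = S"
    using xs ys assms by (auto simp: r_def s_def)
  then have rs: "r \<in> permutations_of_set S" "s \<in> permutations_of_set S"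
    by (auto simp: permutations_of_set_def)
  let ?N = "\<lambda>js. of_bool (js = r) - of_bool (js = s) :: int"
  have "net_votes S ?N B k = of_bool (i \<in> B \<and> j \<in> B \<and> B \<subseteq> A) * transfer_vote i j k"
    if B: "B \<subseteq> S" "k \<in> B" for B k
  proof -
    have "net_votes S ?N B k = of_bool (tops r B k) - of_bool (tops s B k)"
      using rs by (auto simp: net_votes_def sum_subtractf of_bool_def sum.delta)
    moreover have "of_bool (tops r B k) - of_bool (tops s B k)
        = of_bool (i \<in> B \<and> j \<in> B \<and> B \<subseteq> A) * transfer_vote i j k"
    proof (cases "B \<subseteq> A")
      case True
      \<comment> \<open>The common prefix is skipped, so the two winners differ only if
        \<open>i\<close> and \<open>j\<close> both compete.\<close>
      then have "filter (\<lambda>x. x \<in> B) xs = []"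
        using xs by (auto simp: filter_empty_conv)
      then show ?thesis
        using B True dist set assms
        by (auto simp: tops_iff_hd_filter r_def s_def transfer_vote_def)
    next
      case False
      \<comment> \<open>The winner lies in the common prefix, so the two votes cancel.\<close>
      then have "filter (\<lambda>x. x \<in> B) xs \<noteq> []"
        using xs B by (auto simp: filter_empty_conv)
      then show ?thesis
        using B False dist set by (simp add: tops_iff_hd_filter r_def s_def)
    qed
    ultimately show ?thesis by simp
  qed
  then show ?thesis
    unfolding realizable_def by blast
qed

text \<open>The previous transfer acts on all contests between \<open>{i, j}\<close> and
  \<open>A\<close>; those properly inside \<open>A\<close> are subtracted, each being available by
  induction.\<close>

lemma realizable_transfer_single:
  assumes "finite S" "A \<subseteq> S" "i \<in> A" "j \<in> A" "i \<noteq> j"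
  shows "realizable S (\<lambda>B k. of_bool (B = A) * transfer_vote i j k)"
proof -
  have "finite A" using assms finite_subset by blast
  then show ?thesis
    using assms(2-4)
  proof (induction A rule: finite_psubset_induct)
    case (psubset A)
    define P where "P = {C. C \<subset> A \<and> i \<in> C \<and> j \<in> C}"
    have "finite P"
      using psubset.hyps by (auto simp: P_def intro: finite_subset[of _ "Pow A"])
    have "realizable S (\<lambda>B k. \<Sum>C\<in>P. of_bool (B = C) * transfer_vote i j k)"
      by (rule realizable_sum) (use psubset in \<open>auto simp: P_def\<close>)
    then have "realizable S (\<lambda>B k. of_bool (i \<in> B \<and> j \<in> B \<and> B \<subseteq> A) * transfer_vote i j k
        + (-1) * (\<Sum>C\<in>P. of_bool (B = C) * transfer_vote i j k))"
      by (intro realizable_add realizable_scale realizable_transfer_below)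
        (use psubset.prems assms in auto)
    then show ?case
    proof (rule realizable_cong)
      fix B k
      \<comment> \<open>At most the summand \<open>C = B\<close> survives.\<close>
      have "(\<Sum>C\<in>P. of_bool (B = C) * transfer_vote i j k) = of_bool (B \<in> P) * transfer_vote i j k"
        using \<open>finite P\<close> by (simp add: of_bool_def if_distrib[of "\<lambda>x. x * _"] sum.delta cong: if_cong)
      then show "of_bool (i \<in> B \<and> j \<in> B \<and> B \<subseteq> A) * transfer_vote i j k
          + (-1) * (\<Sum>C\<in>P. of_bool (B = C) * transfer_vote i j k)
          = of_bool (B = A) * transfer_vote i j k"
        using psubset.prems by (auto simp: P_def)
    qed
  qed
qed

text \<open>Candidate \<open>k\<close> gains \<open>w k\<close> once for each \<open>j\<close> and
  loses \<open>w i\<close> once for each \<open>i\<close>. The total lost is the same for all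
  \<open>k\<close>, hence vanishes from margins.\<close>

lemma sum_transfer_votes:
  assumes "finite A" "k \<in> A"
  shows "(\<Sum>i\<in>A. \<Sum>j\<in>A. w i * transfer_vote i j k) = int (card A) * w k - sum w A"
proof -
  have inner: "(\<Sum>j\<in>A. w i * transfer_vote i j k) = int (card A) * (if i = k then w k else 0) - w i" for i
    using assms
    by (auto simp: transfer_vote_def right_diff_distrib sum_subtractf of_bool_def sum.delta
        if_distrib[of "\<lambda>x. _ * x"] cong: if_cong)
  have "(\<Sum>i\<in>A. int (card A) * (if i = k then w k else 0)) = int (card A) * w k"
    using assms by (simp add: sum_distrib_left[symmetric])
  then show ?thesis
    by (simp only: inner sum_subtractf)
qed

lemma realizable_margins:
  assumes "finite S"
  shows "realizable S (\<lambda>B k. int (card B) * w B k - sum (w B) B)"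
proof -
  have single: "realizable S (\<lambda>B k. of_bool (B = A) * transfer_vote i j k)"
    if "A \<subseteq> S" "i \<in> A" "j \<in> A" for A i j
  proof (cases "i = j")
    case True
    then show ?thesis by (simp add: transfer_vote_def realizable_zero)
  next
    case False
    with that assms show ?thesis by (intro realizable_transfer_single)
  qed
  have "realizable S (\<lambda>B k. \<Sum>A\<in>Pow S. \<Sum>i\<in>A. \<Sum>j\<in>A. w A i * (of_bool (B = A) * transfer_vote i j k))"
    by (intro realizable_sum realizable_scale single) auto
  then show ?thesis
  proof (rule realizable_cong)
    fix B k assume B: "B \<subseteq> S" "k \<in> B"
    have "(\<Sum>A\<in>Pow S. \<Sum>i\<in>A. \<Sum>j\<in>A. w A i * (of_bool (B = A) * transfer_vote i j k))
        = (\<Sum>A\<in>Pow S. if A = B then \<Sum>i\<in>B. \<Sum>j\<in>B. w B i * transfer_vote i j k else 0)"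
      by (rule sum.cong) auto
    also have "\<dots> = (\<Sum>i\<in>B. \<Sum>j\<in>B. w B i * transfer_vote i j k)"
      using assms B by (simp add: sum.delta)
    also have "\<dots> = int (card B) * w B k - sum (w B) B"
      using assms B by (intro sum_transfer_votes) (auto intro: finite_subset)
    finally show "(\<Sum>A\<in>Pow S. \<Sum>i\<in>A. \<Sum>j\<in>A. w A i * (of_bool (B = A) * transfer_vote i j k))
        = int (card B) * w B k - sum (w B) B" .
  qed
qed

theorem theorem2:
  fixes m :: nat and \<sigma> :: "nat set \<Rightarrow> nat \<Rightarrow> nat"
  assumes "m \<ge> 2" and "\<sigma> \<in> ranking_patterns m"
  shows "\<exists>N. voting_situation m N \<and> q_concordant m \<sigma> N"
proof -
  define S where "S = {1..m}"
  \<comment> \<open>The sign is negative because a smaller rank must earn more votes.\<close>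
  have "realizable S (\<lambda>B k. int (card B) * (- int (\<sigma> B k)) - (\<Sum>i\<in>B. - int (\<sigma> B i)))"
    by (rule realizable_margins[of S "\<lambda>B k. - int (\<sigma> B k)"]) (simp add: S_def)
  then obtain M where M: "\<And>B k. B \<subseteq> S \<Longrightarrow> k \<in> B \<Longrightarrow>
      net_votes S M B k = int (card B) * (- int (\<sigma> B k)) - (\<Sum>i\<in>B. - int (\<sigma> B i))"
    unfolding realizable_def by blast
  \<comment> \<open>The sum bounds every \<open>\<bar>M js\<bar>\<close>; the extra 1 makes all
    shifted counts positive, so that \<open>nat\<close> loses nothing and voters exist.\<close>
  define c where "c = 1 + (\<Sum>js\<in>permutations_of_set S. \<bar>M js\<bar>)"
  define N where "N js = nat (M js + c)" for js
  have pos: "M js + c > 0" if "js \<in> permutations_of_set S" for js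
    using member_le_sum[of js "permutations_of_set S" "\<lambda>js. \<bar>M js\<bar>"] that by (auto simp: c_def)
  have votes: "int (votes m N B k) = net_votes S M B k + net_votes S (\<lambda>_. c) B k" for B k
  proof -
    have "int (votes m N B k) = net_votes S (\<lambda>js. M js + c) B k"
      unfolding votes_def net_votes_def tops_def S_def[symmetric] of_nat_sum
      by (rule sum.cong) (use pos in \<open>auto simp: N_def less_imp_le\<close>)
    then show ?thesis by (simp add: net_votes_add)
  qed
  \<comment> \<open>Both the contribution of \<open>c\<close> and the sum of ranks over
    \<open>A\<close> are equal for \<open>i\<close> and \<open>j\<close>, so they cancel.\<close>
  have margin: "int (votes m N A i) - int (votes m N A j)
      = int (card A) * (int (\<sigma> A j) - int (\<sigma> A i))"
    if "A \<subseteq> S" "i \<in> A" "j \<in> A" for A i j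
    using that net_votes_const_symmetric[of A S i j c] by (simp add: votes M algebra_simps)
  have "q_concordant m \<sigma> N"
    unfolding q_concordant_def S_def[symmetric]
  proof (intro allI impI ballI)
    fix A i j assume A: "A \<subseteq> S" "i \<in> A" "j \<in> A"
    \<comment> \<open>A positive factor preserves the sign of the rank difference.\<close>
    then have "card A > 0" by (auto simp: card_gt_0_iff S_def intro: finite_subset)
    then have "0 < int (card A) * (int (\<sigma> A j) - int (\<sigma> A i)) \<longleftrightarrow> \<sigma> A i < \<sigma> A j"
      and "int (card A) * (int (\<sigma> A j) - int (\<sigma> A i)) = 0 \<longleftrightarrow> \<sigma> A i = \<sigma> A j"
      by (auto simp: zero_less_mult_iff)
    with margin[OF A] show "(\<sigma> A i < \<sigma> A j \<longleftrightarrow> votes m N A i > votes m N A j) \<and>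
        (\<sigma> A i = \<sigma> A j \<longleftrightarrow> votes m N A i = votes m N A j)"
      by linarith
  qed
  moreover have "voting_situation m N"
    unfolding voting_situation_def S_def[symmetric]
    by (rule sum_pos) (use pos in \<open>auto simp: N_def S_def\<close>)
  ultimately show ?thesis by blast
qed

end
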